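(* Let $L\ge 1$ and $k\ge 1$ be integers with $k$ dividing $L$, let $N$ be an $L$-bit integer ($2^{L-1}\le N<2^L$), let $a<N$ be a positive integer with $\gcd(a,N)=1$, let $r$ be the order of $a$ modulo $N$, and let $\epsilon>0$. Let $p,l_j,t_j$, the state $|\phi_{final}\rangle$, the measurement producing $m_1,\dots,m_k$, and the classical procedure CombineResults producing $m$ be as described in the context. Then, with probability at least $1-\epsilon$, the procedure CombineResults succeeds and its output $m$ (a $(2L+1+p)$-bit string, read as an integer) satisfies $$\left|\frac{m}{2^{2L+1+p}}-\frac{s_0}{r}\right|\le 2^{-(2L+1)}$$ for some $s_0\in\{0,1,\dots,r\}$.
   Context: Conventions: bit strings are identified with the binary integers they represent (most significant bit first). For a bit string $x=x_1x_2\cdots x_n$ and $1\le i\le j\le n$, $x_{[i,j]}=x_ix_{i+1}\cdots x_j$. For a real number $\omega$ with binary expansion of its fractional part $0.b_1b_2b_3\cdots$ (not ending in infinitely many 1's), $\omega_{\{i,j\}}=b_ib_{i+1}\cdots b_j$ for $1\le i\le j$. For two $t$-bit strings $x,y$, $d_t(x,y)=\min(|x-y|,2^t-|x-y|)$. For a positive integer $t$ and real $\omega$, $|\psi_{t,\omega}\rangle=QFT^{-1}\frac{1}{\sqrt{2^t}}\sum_{j=0}^{2^t-1}e^{2\pi i j\omega}|j\rangle$, where $QFT|j\rangle=\frac{1}{\sqrt{2^t}}\sum_{x=0}^{2^t-1}e^{2\pi i jx/2^t}|x\rangle$. For $s\in\{0,\dots,r-1\}$, $|u_s\rangle=\frac{1}{\sqrt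 r}\sum_{q=0}^{r-1}e^{-2\pi i sq/r}|a^q \bmod N\rangle$ (an $L$-qubit state); these are orthonormal. Parameters: $p=\lceil\log_2(2+\frac{1}{2\epsilon'})\rceil$ with $\epsilon'=\epsilon/k$; $l_j=(j-1)\frac{L}{k}+1$ for $j=1,\dots,k$ and $l_{k+1}=2L$; $t_j=l_{j+1}+2-l_j+p$ for $j=1,\dots,k$. Measured state: registers $A_1,\dots,A_k$ (register $A_j$ has $t_j$ qubits) and an $L$-qubit register $C$ are in the state $$|\phi_{final}\rangle=\frac{1}{\sqrt r}\sum_{s=0}^{r-1}\Big(\bigotimes_{j=1}^{k}|\psi_{t_j,2^{l_j-1}s/r}\rangle_{A_j}\Big)|u_s\rangle_C$$ (the state produced by the distributed order-finding circuit). In the computational basis, for $j=1,\dots,k-1$ the first $l_{j+1}+2-l_j$ qubits of $A_j$ are measured, giving an $(l_{j+1}+2-l_j)$-bit string $m_j$, and all $t_k$ qubits of $A_k$ are measured, giving a $t_k$-bit string $m_k$. CombineResults: set $m'_k=m_k$. For $u=k-1,k-2,\dots,1$: choose $c_u\in\{-1,0,1\}$ such that (the integer formed by the last two bits of $m_u$) $+c_u \equiv (m'_{u+1})_{[1,2]} \pmod 4$ (if no such $c_u$ exists the procedure fails); set $prefix_u=(m_u+c_u)\bmod 2^{l_{u+1}+2-l_u}$ written as an $(l_{u+1}+2-l_u)$-bit string, and $m'_u=prefix_u\circ (m'_{u+1})_{[3,\,2L+p+2-l_{u+1}]}$, where $\circ$ is concatenation. Output $m=m'_1$. *)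

theory Defs
  imports "HOL-Analysis.Analysis" "HOL-Number_Theory.Number_Theory" "HOL-Library.FuncSet"
begin

definition p_par :: "real \<Rightarrow> nat \<Rightarrow> nat" where
  "p_par \<epsilon> k = nat \<lceil>log 2 (2 + 1 / (2 * (\<epsilon> / real k)))\<rceil>"

definition l_par :: "nat \<Rightarrow> nat \<Rightarrow> nat \<Rightarrow> nat" where
  "l_par L k j = (if j = k + 1 then 2 * L else (j - 1) * (L div k) + 1)"

text \<open>number of measured qubits of register A_j (j < k): l_(j+1) + 2 - l_j\<close>
definition n_par :: "nat \<Rightarrow> nat \<Rightarrow> nat \<Rightarrow> nat" where
  "n_par L k j = l_par L k (j + 1) + 2 - l_par L k j"

definition t_par :: "nat \<Rightarrow> nat \<Rightarrow> nat \<Rightarrow> nat \<Rightarrow> nat" where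
  "t_par L k p j = n_par L k j + p"

section \<open>Quantum states (as amplitude functions on computational basis indices)\<close>

definition qft :: "nat \<Rightarrow> (nat \<Rightarrow> complex) \<Rightarrow> nat \<Rightarrow> complex" where
  "qft t v x = (\<Sum>j<2^t. v j * (cis (2 * pi * real j * real x / 2^t) / sqrt (2^t)))"

definition qft_inv :: "nat \<Rightarrow> (nat \<Rightarrow> complex) \<Rightarrow> nat \<Rightarrow> complex" where
  "qft_inv t v x = (\<Sum>j<2^t. v j * (cis (- (2 * pi * real j * real x / 2^t)) / sqrt (2^t)))"

definition psi :: "nat \<Rightarrow> real \<Rightarrow> nat \<Rightarrow> complex" where
  "psi t \<omega> = qft_inv t (\<lambda>j. if j < 2^t then cis (2 * pi * real j * \<omega>) / sqrt (2^t) else 0)"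

definition u_state :: "nat \<Rightarrow> nat \<Rightarrow> nat \<Rightarrow> nat \<Rightarrow> nat \<Rightarrow> complex" where
  "u_state N a r s c = (\<Sum>q<r. (if a ^ q mod N = c then cis (- (2 * pi * real s * real q / real r)) else 0))
                        / sqrt (real r)"

definition A_basis :: "nat \<Rightarrow> nat \<Rightarrow> nat \<Rightarrow> (nat \<Rightarrow> nat) set" where
  "A_basis L k p = PiE {1..k} (\<lambda>j. {..<2 ^ t_par L k p j})"

definition phi_final :: "nat \<Rightarrow> nat \<Rightarrow> nat \<Rightarrow> nat \<Rightarrow> nat \<Rightarrow> nat \<Rightarrow> (nat \<Rightarrow> nat) \<Rightarrow> nat \<Rightarrow> complex" where
  "phi_final L k p N a r x c =
     (\<Sum>s<r. (\<Prod>j\<in>{1..k}. psi (t_par L k p j) (2 ^ (l_par L k j - 1) * real s / real r) (x j))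
             * u_state N a r s c) / sqrt (real r)"

text \<open>Measurement outcome: for j < k the first n_j (most significant) qubits of A_j,
  i.e. x_j div 2^(t_j - n_j); for j = k all t_k qubits.\<close>
definition meas :: "nat \<Rightarrow> nat \<Rightarrow> nat \<Rightarrow> (nat \<Rightarrow> nat) \<Rightarrow> nat \<Rightarrow> nat" where
  "meas L k p x j = (if j < k then x j div 2 ^ (t_par L k p j - n_par L k j) else x j)"

definition outcome_prob :: "nat \<Rightarrow> nat \<Rightarrow> nat \<Rightarrow> nat \<Rightarrow> nat \<Rightarrow> nat \<Rightarrow> (nat \<Rightarrow> nat) \<Rightarrow> real" where
  "outcome_prob L k p N a r mv =
     (\<Sum>x\<in>{x\<in>A_basis L k p. \<forall>j\<in>{1..k}. meas L k p x j = mv j}.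
        \<Sum>c<2^L. (cmod (phi_final L k p N a r x c))\<^sup>2)"

definition outcomes :: "nat \<Rightarrow> nat \<Rightarrow> nat \<Rightarrow> (nat \<Rightarrow> nat) set" where
  "outcomes L k p = (\<lambda>x. restrict (meas L k p x) {1..k}) ` A_basis L k p"

text \<open>Bit length of m'_u : 2L + p + 2 - l_u.\<close>
definition len_par :: "nat \<Rightarrow> nat \<Rightarrow> nat \<Rightarrow> nat \<Rightarrow> nat" where
  "len_par L k p u = 2 * L + p + 2 - l_par L k u"

definition comb_step :: "nat \<Rightarrow> nat \<Rightarrow> nat \<Rightarrow> (nat \<Rightarrow> nat) \<Rightarrow> nat \<Rightarrow> int \<Rightarrow> int option" where
  "comb_step L k p mv u m' =
     (let mu = int (mv u);
          len' = len_par L k p (u + 1);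
          top2 = m' div 2 ^ (len' - 2);
          C = {c \<in> {-1, 0, 1::int}. (mu mod 4 + c) mod 4 = top2 mod 4}
      in if C = {} then None
         else (let c = (SOME c. c \<in> C);
                   prefix = (mu + c) mod 2 ^ (n_par L k u)
               in Some (prefix * 2 ^ (len' - 2) + m' mod 2 ^ (len' - 2))))"

text \<open>comb_iter d = m'_(k-d) (None if the procedure has failed).\<close>
primrec comb_iter :: "nat \<Rightarrow> nat \<Rightarrow> nat \<Rightarrow> (nat \<Rightarrow> nat) \<Rightarrow> nat \<Rightarrow> int option" where
  "comb_iter L k p mv 0 = Some (int (mv k))"
| "comb_iter L k p mv (Suc d) =
     (case comb_iter L k p mv d of None \<Rightarrow> None
      | Some m' \<Rightarrow> comb_step L k p mv (k - Suc d) m')"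

definition combine_results :: "nat \<Rightarrow> nat \<Rightarrow> nat \<Rightarrow> (nat \<Rightarrow> nat) \<Rightarrow> int option" where
  "combine_results L k p mv = comb_iter L k p mv (k - 1)"

definition good_outcome :: "nat \<Rightarrow> nat \<Rightarrow> nat \<Rightarrow> nat \<Rightarrow> (nat \<Rightarrow> nat) \<Rightarrow> bool" where
  "good_outcome L k p r mv =
     (\<exists>m. combine_results L k p mv = Some m \<and>
        (\<exists>s0\<in>{0..r}. \<bar>real_of_int m / 2 ^ (2 * L + 1 + p) - real s0 / real r\<bar> \<le> 1 / 2 ^ (2 * L + 1)))"

definition success_prob :: "nat \<Rightarrow> nat \<Rightarrow> nat \<Rightarrow> nat \<Rightarrow> nat \<Rightarrow> nat \<Rightarrow> real" where
  "success_prob L k p N a r =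
     (\<Sum>mv\<in>{mv\<in>outcomes L k p. good_outcome L k p r mv}. outcome_prob L k p N a r mv)"

end

theory Submission
  imports Defs "HOL-Library.Real_Mod"
begin

text \<open>
  Since the states u_s are orthonormal, the outcome distribution is the average over s of the
  products of the phase estimation distributions |psi(x_j)|^2. Summing 1 / sin^2 by
  telescoping cotangents shows that the estimate in one register is off by more than
  (3/4) 2^p (modulo 2^t) with probability at most 1 / (3 ((3/4) 2^p - 1/2)) \<le> \<epsilon> / k.

  The factor 3/4 is essential: the textbook error bound 2^p does not suffice, because the truncated
  value m_u and the leading bits of m'_(u+1) may then be rounded in opposite directions and differ
  by 2, so that no correction c_u exists. With 3/4, the scaled error of A_u is at most 3/4 and that
  of m'_(u+1) at most 1/4, so the two integer parts differ by at most 1.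
  By induction each m'_u is then the residue modulo its length of one and the same integer R with
  |R - 2^(2L+1+p) s/r| \<le> (3/4) 2^p.
\<close>

section \<open>Discrete Fourier sums and the normalisation of \<open>psi\<close>\<close>

lemma dft_orthogonality:
  fixes i j n :: nat
  assumes "i < n" "j < n"
  shows "(\<Sum>x<n. cis (2 * pi * (real i - real j) * real x / real n)) = (if i = j then of_nat n else 0)"
proof (cases "i = j")
  case False
  define z where "z = cis (2 * pi * (real i - real j) / real n)"
  have "z \<noteq> 1"
  proof
    assume "z = 1"
    then obtain m :: int where "2 * pi * (real i - real j) / real n = of_int m * (2 * pi)"
      by (auto simp: z_def cis_eq_1_iff)
    then have "2 * pi * (real i - real j) = 2 * pi * (of_int m * real n)"
      using assms by (simp add: divide_eq_eq mult_ac)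
    then have "real i - real j = of_int m * real n" by simp
    then have "real_of_int (int i - int j) = of_int (m * int n)" by simp
    then have "int i - int j = m * int n" using of_int_eq_iff by blast
    moreover have "\<bar>int i - int j\<bar> < int n" using assms by auto
    ultimately have "\<bar>m\<bar> * int n < 1 * int n" by (simp add: abs_mult)
    then have "m = 0" using assms by (simp add: mult_less_cancel_right)
    with \<open>int i - int j = m * int n\<close> False show False by simp
  qed
  have "z ^ n = cis (2 * pi * of_int (int i - int j))"
    unfolding z_def Complex.DeMoivre using assms by simp
  also have "\<dots> = 1" by (rule cis_multiple_2pi) simp
  finally have "z ^ n = 1" .
  have "(\<Sum>x<n. cis (2 * pi * (real i - real j) * real x / real n)) = (\<Sum>x<n. z ^ x)"
    unfolding z_def Complex.DeMoivre by (intro sum.cong refl arg_cong[of _ _ cis]) simp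
  then show ?thesis using False \<open>z \<noteq> 1\<close> \<open>z ^ n = 1\<close> by (simp add: geometric_sum)
qed simp

text \<open>Needed for two different transforms: with n = 2^t it normalises \<open>psi\<close>, and
  with n = r it removes the interference between different s in the final state, taking the place of
  the orthonormality of the u_s. Expanding the square gives a triple sum; summing over x first
  leaves only the diagonal i = j.\<close>

lemma parseval_dft:
  fixes v :: "nat \<Rightarrow> complex"
  shows "(\<Sum>x<n. (cmod (\<Sum>j<n. v j * cis (- (2 * pi * real j * real x / real n))))\<^sup>2)
         = real n * (\<Sum>j<n. (cmod (v j))\<^sup>2)"
proof -
  have e: "cis (- (2 * pi * real i * real x / real n)) * cis (2 * pi * real j * real x / real n)
     = cis (2 * pi * (real j - real i) * real x / real n)" for i j x
    unfolding cis_mult by (intro arg_cong[of _ _ cis]) (simp add: algebra_simps diff_divide_distrib)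
  have "complex_of_real (\<Sum>x<n. (cmod (\<Sum>j<n. v j * cis (- (2 * pi * real j * real x / real n))))\<^sup>2)
     = (\<Sum>x<n. \<Sum>i<n. \<Sum>j<n. v i * cnj (v j)
          * (cis (- (2 * pi * real i * real x / real n)) * cis (2 * pi * real j * real x / real n)))"
    unfolding of_real_sum complex_norm_square cnj_sum sum_product
    by (intro sum.cong refl) (simp add: cis_cnj mult_ac)
  also have "\<dots> = (\<Sum>i<n. \<Sum>j<n. \<Sum>x<n. v i * cnj (v j) * cis (2 * pi * (real j - real i) * real x / real n))"
    unfolding e by (subst sum.swap) (intro sum.cong refl sum.swap)
  also have "\<dots> = (\<Sum>i<n. \<Sum>j<n. v i * cnj (v j) * (if j = i then of_nat n else 0))"
    by (intro sum.cong refl, subst sum_distrib_left[symmetric], subst dft_orthogonality) auto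
  also have "\<dots> = (\<Sum>i<n. v i * cnj (v i) * of_nat n)"
    by (intro sum.cong refl) (simp add: if_distrib cong: if_cong)
  also have "\<dots> = complex_of_real (real n * (\<Sum>j<n. (cmod (v j))\<^sup>2))"
    unfolding of_real_mult of_real_sum complex_norm_square sum_distrib_left
    by (intro sum.cong refl) simp
  finally show ?thesis using of_real_eq_iff by blast
qed

lemma psi_eq_sum:
  "psi t \<omega> x = (\<Sum>j<2 ^ t. cis (2 * pi * real j * \<omega>) * cis (- (2 * pi * real j * real x / 2 ^ t))) / 2 ^ t"
proof -
  have s: "complex_of_real (sqrt (2 ^ t)) * complex_of_real (sqrt (2 ^ t)) = 2 ^ t"
    unfolding of_real_mult[symmetric] by simp
  show ?thesis
    by (simp add: psi_def qft_inv_def sum_divide_distrib s)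
qed

lemma psi_norm: "(\<Sum>x<2 ^ t. (cmod (psi t \<omega> x))\<^sup>2) = 1"
  using parseval_dft[where n = "2 ^ t" and v = "\<lambda>j. cis (2 * pi * real j * \<omega>)"]
  by (simp add: psi_eq_sum norm_divide norm_mult norm_power power_divide sum_divide_distrib[symmetric]
        power2_eq_square)

section \<open>Tail of the phase estimation distribution\<close>

lemma cmod_one_minus_cis_squared: "(cmod (1 - cis a))\<^sup>2 = 4 * (sin (a / 2))\<^sup>2"
proof -
  have "(cmod (1 - cis a))\<^sup>2 = 2 - 2 * cos a"
    using sin_cos_squared_add[of a] by (simp add: cmod_power2 power2_diff)
  also have "\<dots> = 4 * (sin (a / 2))\<^sup>2"
    using cos_double_sin[of "a / 2"] by simp
  finally show ?thesis .
qed

text \<open>The amplitude is a geometric sum with ratio \<open>cis \<theta>\<close>. Its squared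
  modulus is a quotient of squared sines, in which the numerator is at most 1.\<close>

lemma psi_bound:
  assumes "sin (pi * (\<omega> - real x / 2 ^ t)) \<noteq> 0"
  shows "(cmod (psi t \<omega> x))\<^sup>2 \<le> 1 / ((2 ^ t)\<^sup>2 * (sin (pi * (\<omega> - real x / 2 ^ t)))\<^sup>2)"
proof -
  define \<theta> where "\<theta> = 2 * pi * (\<omega> - real x / 2 ^ t)"
  have h: "\<theta> / 2 = pi * (\<omega> - real x / 2 ^ t)" by (simp add: \<theta>_def)
  have ne: "cis \<theta> \<noteq> 1"
  proof
    assume "cis \<theta> = 1"
    with cmod_one_minus_cis_squared[of \<theta>] assms show False unfolding h by simp
  qed
  have "psi t \<omega> x = (\<Sum>j<2 ^ t. cis \<theta> ^ j) / 2 ^ t"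
  proof -
    have "cis (2 * pi * real j * \<omega>) * cis (- (2 * pi * real j * real x / 2 ^ t)) = cis \<theta> ^ j" for j
      unfolding \<theta>_def Complex.DeMoivre cis_mult
      by (intro arg_cong[of _ _ cis]) (simp add: algebra_simps)
    then show ?thesis by (simp add: psi_eq_sum)
  qed
  also have "\<dots> = (1 - cis (2 ^ t * \<theta>)) / ((1 - cis \<theta>) * 2 ^ t)"
    using ne Complex.DeMoivre[of \<theta> "2 ^ t"] by (simp add: sum_gp_strict)
  finally have "(cmod (psi t \<omega> x))\<^sup>2
      = (cmod (1 - cis (2 ^ t * \<theta>)))\<^sup>2 / ((cmod (1 - cis \<theta>))\<^sup>2 * (2 ^ t)\<^sup>2)"
    by (simp add: norm_divide norm_mult norm_power power_divide power_mult_distrib)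
  also have "\<dots> = (sin (2 ^ t * \<theta> / 2))\<^sup>2 / ((2 ^ t)\<^sup>2 * (sin (\<theta> / 2))\<^sup>2)"
    by (simp add: cmod_one_minus_cis_squared)
  also have "\<dots> \<le> 1 / ((2 ^ t)\<^sup>2 * (sin (\<theta> / 2))\<^sup>2)"
    by (intro divide_right_mono) (auto simp: power_le_one_iff abs_square_le_1)
  finally show ?thesis unfolding h .
qed

lemma mult_cos_le_sin:
  fixes x :: real
  assumes "0 \<le> x" "x \<le> pi"
  shows "x * cos x \<le> sin x"
proof -
  have "sin 0 - 0 * cos 0 \<le> sin x - x * cos x"
  proof (rule DERIV_nonneg_imp_nondecreasing[of 0 x "\<lambda>y. sin y - y * cos y"])
    fix y assume "0 \<le> y" "y \<le> x"
    then have "((\<lambda>y. sin y - y * cos y) has_real_derivative y * sin y) (at y)" "0 \<le> y * sin y"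
      using assms by (auto intro!: derivative_eq_intros mult_nonneg_nonneg sin_ge_zero)
    then show "\<exists>d. ((\<lambda>y. sin y - y * cos y) has_real_derivative d) (at y) \<and> 0 \<le> d" by blast
  qed (use assms in auto)
  then show ?thesis by simp
qed

lemma cot_le_inverse:
  fixes x :: real
  assumes "0 < x" "x < pi"
  shows "cot x \<le> 1 / x"
  using mult_cos_le_sin[of x] sin_gt_zero[of x] assms
  by (simp add: cot_def divide_simps mult.commute)

text \<open>This makes the tail sum telescope. The cotangent difference equals sin h / (sin (x -
  h/2) * sin (x + h/2)), and that product of sines is sin^2 x - sin^2 (h/2), hence at most sin^2
  x.\<close>

lemma inverse_sin_squared_le:
  fixes x h :: real
  assumes "0 < h" "h / 2 < x" "x + h / 2 < pi"
  shows "1 / (sin x)\<^sup>2 \<le> (cot (x - h / 2) - cot (x + h / 2)) / sin h"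
proof -
  have pos: "0 < sin (x - h / 2)" "0 < sin (x + h / 2)" "0 < sin h" "0 < sin x"
    using assms by (auto intro!: sin_gt_zero)
  have "sin h = sin (x + h / 2) * cos (x - h / 2) - cos (x + h / 2) * sin (x - h / 2)"
    using sin_diff[of "x + h / 2" "x - h / 2"] by simp
  then have "(cot (x - h / 2) - cot (x + h / 2)) / sin h = 1 / (sin (x - h / 2) * sin (x + h / 2))"
    using pos by (simp add: cot_def diff_frac_eq mult.commute)
  moreover have "sin (x - h / 2) * sin (x + h / 2) = (sin x)\<^sup>2 - (sin (h / 2))\<^sup>2"
  proof -
    have c: "(cos y)\<^sup>2 = 1 - (sin y)\<^sup>2" for y :: real using sin_cos_squared_add[of y] by linarith
    have "sin (x - h / 2) * sin (x + h / 2) = (sin x)\<^sup>2 * (cos (h / 2))\<^sup>2 - (cos x)\<^sup>2 * (sin (h / 2))\<^sup>2"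
      by (simp add: sin_add sin_diff power2_eq_square algebra_simps)
    then show ?thesis by (simp add: c algebra_simps)
  qed
  moreover have "0 < sin (x - h / 2) * sin (x + h / 2)" using pos by simp
  ultimately show ?thesis
    using pos(4) by (auto intro!: divide_left_mono mult_pos_pos)
qed

text \<open>The squared sine has period pi, so shifting the outcome by a multiple of 2^t leaves the
  bound unchanged; the condition 0 < v < 2^t keeps the sine positive.\<close>

lemma psi_bound_shifted:
  assumes "real x - 2 ^ t * \<omega> = v + of_int q * 2 ^ t" and "0 < v" "v < 2 ^ t"
  shows "(cmod (psi t \<omega> x))\<^sup>2 \<le> 1 / ((2 ^ t)\<^sup>2 * (sin (pi / 2 ^ t * v))\<^sup>2)"
proof -
  have "pi * (\<omega> - real x / 2 ^ t) = - (pi / 2 ^ t * v + pi * of_int q)"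
    using assms(1) by (simp add: field_simps)
  then have "(sin (pi * (\<omega> - real x / 2 ^ t)))\<^sup>2 = (sin (pi / 2 ^ t * v + pi * of_int q))\<^sup>2"
    by (simp only: sin_minus power2_minus)
  also have "\<dots> = (sin (pi / 2 ^ t * v))\<^sup>2 * (cos (pi * of_int q))\<^sup>2"
    by (simp add: sin_add power_mult_distrib sin_npi_int)
  also have "(cos (pi * of_int q))\<^sup>2 = 1"
    using sin_cos_squared_add[of "pi * of_int q"] by (simp add: sin_npi_int)
  finally have e: "(sin (pi * (\<omega> - real x / 2 ^ t)))\<^sup>2 = (sin (pi / 2 ^ t * v))\<^sup>2" by simp
  have "pi / 2 ^ t * v < pi" using assms by (simp add: divide_less_eq)
  then have "0 < sin (pi / 2 ^ t * v)" using assms by (intro sin_gt_zero) auto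
  then have "sin (pi * (\<omega> - real x / 2 ^ t)) \<noteq> 0" using e by auto
  from psi_bound[OF this] show ?thesis unfolding e .
qed

text \<open>Follows from h * cos h <= sin h, since cos h >= cos (pi/4) = sqrt 2 / 2 >= 2/3 on this
  interval. The constant 2/3 is what turns 2 into 3 in the tail estimate.\<close>

lemma sin_ge_two_thirds:
  fixes h :: real
  assumes "0 \<le> h" "h \<le> pi / 4"
  shows "2 / 3 * h \<le> sin h"
proof -
  have "4 / 3 \<le> sqrt 2" by (rule real_le_rsqrt) (simp add: power2_eq_square)
  then have "2 / 3 \<le> sqrt 2 / 2" by simp
  also have "\<dots> = cos (pi / 4)" by (simp add: cos_45)
  also have "\<dots> \<le> cos h" using assms by (intro cos_monotone_0_pi_le) auto
  finally have "h * (2 / 3) \<le> h * cos h" using assms by (intro mult_left_mono) auto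
  then show ?thesis using mult_cos_le_sin[of h] assms by (simp add: mult.commute)
qed

lemma sum_inverse_sin_squared_le:
  fixes M \<gamma> T :: real
  assumes M: "4 \<le> M" and T: "1 \<le> T" and \<gamma>: "0 \<le> \<gamma>" "\<gamma> < 1"
  defines "I \<equiv> {i::nat. T < real i + \<gamma> \<and> real i + \<gamma> < M - T}"
  shows "finite I" "(\<Sum>i\<in>I. 1 / (M\<^sup>2 * (sin (pi / M * (real i + \<gamma>)))\<^sup>2)) \<le> 1 / (3 * (T - 1 / 2))"
proof -
  define h where "h = pi / M"
  define G where "G i = cot (h * (real i + \<gamma> - 1 / 2))" for i :: nat
  \<comment> \<open>The inequalities defining \<open>I\<close> are strict at both ends:
    \<open>m\<close> is the first index beyond T, and \<open>n\<close> the first index no longer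
    below M - T.\<close>
  define m where "m = nat (\<lfloor>T - \<gamma>\<rfloor> + 1)"
  define n where "n = nat \<lceil>M - T - \<gamma>\<rceil>"
  have h: "0 < h" "h * M = pi" "h \<le> pi / 4" using M by (auto simp: h_def field_simps)
  have sinh: "2 / 3 * h \<le> sin h" using sin_ge_two_thirds h by simp
  have I: "I = {m..<n}"
  proof (rule Set.set_eqI)
    fix i :: nat
    have "T < real i + \<gamma> \<longleftrightarrow> m \<le> i" using T \<gamma> unfolding m_def by linarith
    moreover have "real i + \<gamma> < M - T \<longleftrightarrow> i < n" unfolding n_def by linarith
    ultimately show "i \<in> I \<longleftrightarrow> i \<in> {m..<n}" by (simp add: I_def)
  qed
  then show "finite I" by simp
  show "(\<Sum>i\<in>I. 1 / (M\<^sup>2 * (sin (pi / M * (real i + \<gamma>)))\<^sup>2)) \<le> 1 / (3 * (T - 1 / 2))"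
  proof (cases "m < n")
    case False
    then show ?thesis using T I by simp
  next
    case True
    have "(\<Sum>i\<in>I. 1 / (M\<^sup>2 * (sin (pi / M * (real i + \<gamma>)))\<^sup>2))
        = (\<Sum>i = m..<n. 1 / (sin (h * (real i + \<gamma>)))\<^sup>2) / M\<^sup>2"
      by (simp add: I h_def sum_divide_distrib mult.commute)
    also have "\<dots> \<le> (\<Sum>i = m..<n. (G i - G (Suc i)) / sin h) / M\<^sup>2"
    proof (intro divide_right_mono sum_mono)
      fix i assume "i \<in> {m..<n}"
      then have "i \<in> I" by (simp add: I)
      then have "T < real i + \<gamma>" "real i + \<gamma> < M - T" by (simp_all add: I_def)
      then have "h * (1 / 2) < h * (real i + \<gamma>)" "h * (real i + \<gamma> + 1 / 2) < h * M"
        using h(1) T by (auto intro!: mult_strict_left_mono)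
      then show "1 / (sin (h * (real i + \<gamma>)))\<^sup>2 \<le> (G i - G (Suc i)) / sin h"
        using inverse_sin_squared_le[of h "h * (real i + \<gamma>)"] h by (simp add: G_def algebra_simps)
    qed simp
    also have "(\<Sum>i = m..<n. (G i - G (Suc i)) / sin h) = (G m - G n) / sin h"
      using sum_Suc_diff'[of m n "\<lambda>i. - G i"] True by (simp add: sum_divide_distrib[symmetric])
    \<comment> \<open>Both cotangent arguments stay at least \<open>h * (T - 1 / 2)\<close> away
      from the poles 0 and pi, so cot y <= 1 / y bounds each end; the upper end is reflected by -cot
      y = cot (pi - y).\<close>
    also have "G m - G n \<le> 2 / (h * (T - 1 / 2))"
    proof -
      have mn: "T < real m + \<gamma>" "real m + \<gamma> < real n + \<gamma>" "real n + \<gamma> < M - T + 1" "real m + \<gamma> < M - T"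
        using True T \<gamma> unfolding m_def n_def by linarith+
      have low: "0 < h * (T - 1 / 2)" using h T by simp
      have a: "h * (T - 1 / 2) \<le> h * (real m + \<gamma> - 1 / 2)" "h * (real m + \<gamma> - 1 / 2) < h * M"
        using h(1) mn T by (auto intro!: mult_left_mono mult_strict_left_mono)
      have a0: "0 < h * (real m + \<gamma> - 1 / 2)" using a(1) low by linarith
      have "0 < h * (real n + \<gamma> - 1 / 2)" using h mn T by simp
      moreover have "h * (T - 1 / 2) \<le> h * (M - (real n + \<gamma> - 1 / 2))"
        using h(1) mn T by (auto intro!: mult_left_mono)
      then have b: "h * (T - 1 / 2) \<le> pi - h * (real n + \<gamma> - 1 / 2)"
        using h(2) by (simp add: right_diff_distrib)
      ultimately have "cot (pi - h * (real n + \<gamma> - 1 / 2)) \<le> 1 / (pi - h * (real n + \<gamma> - 1 / 2))"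
        using low by (intro cot_le_inverse) auto
      also have "\<dots> \<le> 1 / (h * (T - 1 / 2))" using b low by (intro divide_left_mono) auto
      finally have "- G n \<le> 1 / (h * (T - 1 / 2))" by (simp add: G_def cot_def)
      moreover have "G m \<le> 1 / (h * (real m + \<gamma> - 1 / 2))"
        unfolding G_def using a0 a(2) h(2) by (intro cot_le_inverse) auto
      moreover have "\<dots> \<le> 1 / (h * (T - 1 / 2))"
        using low a(1) by (rule frac_le[OF zero_le_one order_refl])
      ultimately show ?thesis by simp
    qed
    \<comment> \<open>The estimate sin h >= 2/3 h reduces everything to \<open>h * M\<close>, which
      is pi; then pi^2 >= 9 gives the final constant.\<close>
    also have "2 / (h * (T - 1 / 2)) / sin h / M\<^sup>2 \<le> 2 / (h * (T - 1 / 2)) / (2 / 3 * h) / M\<^sup>2"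
      using sinh h T by (intro divide_right_mono divide_left_mono) auto
    also have "\<dots> = 3 / ((h * M)\<^sup>2 * (T - 1 / 2))" by (simp add: power2_eq_square)
    also have "\<dots> \<le> 3 / (9 * (T - 1 / 2))"
    proof -
      have "3\<^sup>2 \<le> pi\<^sup>2" using pi_gt3 by (intro power_mono) auto
      then show ?thesis using T h by (intro divide_left_mono mult_right_mono) auto
    qed
    also have "\<dots> = 1 / (3 * (T - 1 / 2))" by (simp add: divide_simps)
    finally show ?thesis using sinh h by (simp add: divide_right_mono)
  qed
qed

text \<open>A real counterpart of the circular distance d_t: \<open>2 ^ t * \<omega>\<close> is not
  truncated to t bits first, so no rounding error is added to T. The free multiple of 2^t also
  covers phases \<omega> outside [0, 1).\<close>

definition circ_close :: "nat \<Rightarrow> real \<Rightarrow> real \<Rightarrow> nat \<Rightarrow> bool" where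
  "circ_close t \<omega> T x \<longleftrightarrow> (\<exists>z::int. \<bar>real x - 2 ^ t * \<omega> - of_int z * 2 ^ t\<bar> \<le> T)"

text \<open>Far outcomes are re-indexed by their residue \<open>f x\<close> relative to the rounded
  phase. This map is injective into the index set of the preceding sum, and each probability is
  bounded by the corresponding summand.\<close>

lemma psi_tail:
  assumes t: "2 \<le> t" and T: "1 \<le> T"
  shows "(\<Sum>x | x < 2 ^ t \<and> \<not> circ_close t \<omega> T x. (cmod (psi t \<omega> x))\<^sup>2) \<le> 1 / (3 * (T - 1 / 2))"
proof -
  define M :: real where "M = 2 ^ t"
  \<comment> \<open>Rounding up puts \<open>\<gamma>\<close> in [0, 1), so
    \<open>f x + \<gamma>\<close> is the upward distance from \<open>2 ^ t * \<omega>\<close> to x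
    modulo 2^t.\<close>
  define c where "c = \<lceil>2 ^ t * \<omega>\<rceil>"
  define \<gamma> where "\<gamma> = of_int c - 2 ^ t * \<omega>"
  define f where "f x = nat ((int x - c) mod 2 ^ t)" for x
  define B where "B = {x. x < 2 ^ t \<and> \<not> circ_close t \<omega> T x}"
  define I where "I = {i::nat. T < real i + \<gamma> \<and> real i + \<gamma> < M - T}"
  define F where "F i = 1 / (M\<^sup>2 * (sin (pi / M * (real i + \<gamma>)))\<^sup>2)" for i :: nat
  have \<gamma>: "0 \<le> \<gamma>" "\<gamma> < 1" unfolding \<gamma>_def c_def by linarith+
  have "(2::real) ^ 2 \<le> 2 ^ t" using t by (intro power_increasing) auto
  then have M: "4 \<le> M" by (simp add: M_def)
  have split: "real x - 2 ^ t * \<omega> = real (f x) + \<gamma> + of_int ((int x - c) div 2 ^ t) * 2 ^ t" for x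
  proof -
    have "int x - c = int (f x) + (int x - c) div 2 ^ t * 2 ^ t" by (simp add: f_def mod_div_mult_eq)
    then have "real_of_int (int x - c) = of_int (int (f x) + (int x - c) div 2 ^ t * 2 ^ t)" by simp
    then show ?thesis by (simp add: \<gamma>_def)
  qed
  have fI: "f x \<in> I" if "x \<in> B" for x
  proof -
    define q where "q = (int x - c) div 2 ^ t"
    have nc: "T < \<bar>real x - 2 ^ t * \<omega> - of_int z * 2 ^ t\<bar>" for z :: int
      using that by (auto simp: B_def circ_close_def not_le)
    have "int (f x) < 2 ^ t" by (simp add: f_def)
    then have "Suc (f x) \<le> 2 ^ t" by simp
    then have "real (Suc (f x)) \<le> real (2 ^ t)" by (simp only: of_nat_le_iff)
    then have "real (f x) + 1 \<le> M" by (simp add: M_def)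
    \<comment> \<open>The multiples \<open>q\<close> and \<open>q + 1\<close> are the wrap-arounds
      just below and just above; not being close for either gives the two bounds that define
      \<open>I\<close>.\<close>
    moreover have "T < real (f x) + \<gamma>" using nc[of q] \<gamma> split[of x] by (simp add: q_def)
    moreover have "T < \<bar>real (f x) + \<gamma> - M\<bar>"
      using nc[of "q + 1"] split[of x] by (simp add: q_def M_def algebra_simps)
    ultimately show ?thesis using \<gamma> by (auto simp: I_def)
  qed
  have inj: "inj_on f B"
  proof (rule inj_onI)
    fix x y assume xy: "x \<in> B" "y \<in> B" "f x = f y"
    then have "(int x - c) mod 2 ^ t = (int y - c) mod 2 ^ t" by (simp add: f_def nat_eq_iff2)
    then have "int x mod 2 ^ t = int y mod 2 ^ t" by (simp add: mod_diff_left_eq mod_eq_dvd_iff)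
    moreover have "int x < 2 ^ t" "int y < 2 ^ t" using xy by (auto simp: B_def)
    ultimately show "x = y" by simp
  qed
  have "(cmod (psi t \<omega> x))\<^sup>2 \<le> F (f x)" if "x \<in> B" for x
    unfolding F_def M_def using fI[OF that] T
    by (intro psi_bound_shifted[OF split]) (auto simp: I_def M_def)
  then have "(\<Sum>x\<in>B. (cmod (psi t \<omega> x))\<^sup>2) \<le> (\<Sum>x\<in>B. F (f x))" by (rule sum_mono)
  also have "\<dots> = sum F (f ` B)" using inj by (simp add: sum.reindex)
  also have "\<dots> \<le> sum F I"
    using fI sum_inverse_sin_squared_le(1)[OF M T \<gamma>]
    by (intro sum_mono2) (auto simp: I_def F_def)
  also have "\<dots> \<le> 1 / (3 * (T - 1 / 2))"
    using sum_inverse_sin_squared_le(2)[OF M T \<gamma>] by (simp add: I_def F_def)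
  finally show ?thesis by (simp add: B_def)
qed

section \<open>Correctness of CombineResults\<close>

lemma l_par_eq: "j \<le> k \<Longrightarrow> l_par L k j = (j - 1) * (L div k) + 1"
  by (simp add: l_par_def)

text \<open>Both inputs are readings of one integer R: the tail holds its low w + 2 bits, and
  \<open>mv u\<close> holds its bits from position w upwards, shifted by c. Since 4 divides 2^n, the
  last two bits of \<open>mv u\<close> determine c modulo 4, and -1, 0, 1 are incongruent modulo 4;
  so the choice operator must return c, and the corrected prefix extends the low bits of R.\<close>

lemma comb_step_eq:
  fixes R c :: int
  assumes len: "len_par L k p (u + 1) = w + 2" and n: "2 \<le> n_par L k u"
    and c: "c \<in> {-1, 0, 1}"
    and mv: "int (mv u) mod 2 ^ n_par L k u = (R div 2 ^ w - c) mod 2 ^ n_par L k u"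
  shows "comb_step L k p mv u (R mod 2 ^ (w + 2)) = Some (R mod 2 ^ (n_par L k u + w))"
proof -
  define Q where "Q = R div 2 ^ w"
  \<comment> \<open>Used with i = 2 to take the tail apart and with i = \<open>n_par L k u\<close>
    to assemble the result.\<close>
  have split: "R mod 2 ^ (w + i) = 2 ^ w * (Q mod 2 ^ i) + R mod 2 ^ w" for i
    unfolding Q_def power_add by (rule zmod_zmult2_eq) simp
  have top: "R mod 2 ^ (w + 2) div 2 ^ w = Q mod 4"
    unfolding split by simp
  have low: "R mod 2 ^ (w + 2) mod 2 ^ w = R mod 2 ^ w"
    unfolding split by simp
  obtain i where i: "n_par L k u = i + 2" using n by (metis add.commute le_Suc_ex)
  have "(4::int) dvd 2 ^ n_par L k u" unfolding i power_add by simp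
  then have m4: "int (mv u) mod 4 = (Q - c) mod 4"
    using mv mod_mod_cancel[of 4 "2 ^ n_par L k u"] by (metis Q_def)
  have "(int (mv u) mod 4 + d) mod 4 = Q mod 4 mod 4 \<longleftrightarrow> d = c" if "d \<in> {-1, 0, 1}" for d
  proof -
    have "(int (mv u) mod 4 + d) mod 4 = (Q - c + d) mod 4" unfolding m4 by (rule mod_add_left_eq)
    then have "(int (mv u) mod 4 + d) mod 4 = Q mod 4 mod 4 \<longleftrightarrow> (Q - c + d) mod 4 = Q mod 4"
      by simp
    also have "\<dots> \<longleftrightarrow> 4 dvd d - c"
      by (simp add: mod_eq_dvd_iff)
    also have "\<dots> \<longleftrightarrow> d = c" using c that by auto
    finally show ?thesis .
  qed
  then have C: "{d \<in> {-1, 0, 1::int}. (int (mv u) mod 4 + d) mod 4 = Q mod 4 mod 4} = {c}"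
    using c by blast
  have "(int (mv u) + c) mod 2 ^ n_par L k u = (R div 2 ^ w - c + c) mod 2 ^ n_par L k u"
    using mv by (rule mod_add_cong) simp
  then have pre: "(int (mv u) + c) mod 2 ^ n_par L k u = Q mod 2 ^ n_par L k u" by (simp add: Q_def)
  show ?thesis
    unfolding comb_step_def Let_def len add_diff_cancel_right' top low C
    using split[of "n_par L k u"] by (simp add: pre add.commute[of w] add.commute[of "_ * _"] mult.commute)
qed

lemma div_eq_floor: "(a::int) div 2 ^ n = \<lfloor>real_of_int a / 2 ^ n\<rfloor>"
  using floor_divide_of_int_eq[of a "2 ^ n", where ?'a = real] by simp

text \<open>The integer R is m'_(k - d) with the wrap-around modulo its bit length undone.\<close>
lemma comb_iter_approx:
  fixes \<Omega> :: real
  assumes k: "k dvd L" "1 \<le> k" "2 \<le> L"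
    and x: "\<And>j. j \<in> {1..k} \<Longrightarrow> x j < 2 ^ t_par L k p j"
    and mv: "\<And>j. j \<in> {1..k} \<Longrightarrow> mv j = meas L k p x j"
    and close: "\<And>j. j \<in> {1..k} \<Longrightarrow>
      circ_close (t_par L k p j) (2 ^ (l_par L k j - 1) * \<Omega>) (3 / 4 * 2 ^ p) (x j)"
    and d: "d < k"
  shows "\<exists>R::int. comb_iter L k p mv d = Some (R mod 2 ^ len_par L k p (k - d))
           \<and> \<bar>of_int R - 2 ^ (2 * L + p + 1) * \<Omega>\<bar> \<le> 3 / 4 * 2 ^ p"
  using d
proof (induction d)
  case 0
  define t where "t = t_par L k p k"
  obtain g where g: "L = k * g" using k by blast
  have g0: "1 \<le> g" using g k by (cases g) auto
  have "(k - 1) * g + g = L" using k g by (cases k) auto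
  then have lk: "l_par L k k + g = L + 1" using k g by (simp add: l_par_eq)
  then have "l_par L k k \<le> L" using g0 by simp
  have l1: "1 \<le> l_par L k k" by (simp add: l_par_eq)
  \<comment> \<open>By the second equation, register k, which carries the phase scaled by 2^(l_k -
    1), is compared with \<open>2 ^ (2 * L + p + 1) * \<Omega>\<close> itself.\<close>
  then have t: "t = 2 * L + p + 2 - l_par L k k" "t + (l_par L k k - 1) = 2 * L + p + 1"
    using k lk l1 by (auto simp: t_def t_par_def n_par_def l_par_def[of L k "Suc k"])
  have len: "len_par L k p k = t" by (simp add: len_par_def t)
  obtain z :: int where z: "\<bar>real (x k) - 2 ^ t * (2 ^ (l_par L k k - 1) * \<Omega>) - of_int z * 2 ^ t\<bar> \<le> 3 / 4 * 2 ^ p"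
    using close[of k] k by (auto simp: circ_close_def t_def)
  define R where "R = int (x k) - z * 2 ^ t"
  have "int (x k) < 2 ^ t" using x[of k] k by (simp add: t_def)
  moreover have "int (x k) = R + z * 2 ^ t" by (simp add: R_def)
  then have "R mod 2 ^ t = int (x k) mod 2 ^ t" by simp
  ultimately have "R mod 2 ^ t = int (mv k)"
    using mv[of k] k by (simp add: meas_def)
  moreover have "\<bar>of_int R - 2 ^ (2 * L + p + 1) * \<Omega>\<bar> \<le> 3 / 4 * 2 ^ p"
    using z unfolding t(2)[symmetric] by (simp add: R_def power_add algebra_simps)
  ultimately show ?case by (intro exI[of _ R]) (simp add: len)
next
  case (Suc d)
  then obtain R :: int where IH: "comb_iter L k p mv d = Some (R mod 2 ^ len_par L k p (k - d))"
    and R: "\<bar>of_int R - 2 ^ (2 * L + p + 1) * \<Omega>\<bar> \<le> 3 / 4 * 2 ^ p"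
    by auto
  obtain g where g: "L = k * g" using k by blast
  have g0: "1 \<le> g" using g k by (cases g) auto
  have gd: "L div k = g" using g k by simp
  define v where "v = k - Suc (Suc d)"
  define u where "u = Suc v"
  \<comment> \<open>\<open>w\<close> counts the bits of m'_(u+1) below its top two. \<open>y\<close>
    is the exact value at the scale where both readings are integer parts: register u approximates
    2^p y, while R approximates 2^w y.\<close>
  define w where "w = p + (k + Suc d) * g - 1"
  define y where "y = 2 ^ (u * g + 2) * \<Omega>"
  have u: "u = k - Suc d" "k - d = u + 1" "u < k" "1 \<le> u" "k = Suc v + Suc d"
    using Suc.prems by (auto simp: u_def v_def)
  have ge: "3 \<le> (k + Suc d) * g"
  proof -
    have "3 * 1 \<le> (k + Suc d) * g" using u g0 by (intro mult_le_mono) auto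
    then show ?thesis by simp
  qed
  have lu: "l_par L k u = v * g + 1" "l_par L k (u + 1) = v * g + g + 1"
    using u(3) gd by (simp_all add: l_par_eq u_def)
  have L: "L = v * g + g + (g + d * g)" using g u(5) by (simp add: algebra_simps)
  have kd: "(k + Suc d) * g = v * g + g + (g + d * g) + (g + d * g)"
    using u(5) by (simp add: algebra_simps)
  have n: "n_par L k u = g + 2" unfolding n_par_def lu by simp
  have t: "t_par L k p u = g + 2 + p" by (simp add: t_par_def n)
  have len1: "len_par L k p (u + 1) = w + 2" using L g0 unfolding len_par_def lu w_def kd by simp
  have len: "len_par L k p u = n_par L k u + w" using L g0 unfolding len_par_def lu w_def kd n by simp
  have K: "2 * L + p + 1 = w + (u * g + 2)" using L g0 unfolding w_def kd u_def by simp
  have pw: "p + 2 \<le> w" using ge unfolding w_def by simp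
  obtain z :: int where z: "\<bar>real (x u) - 2 ^ (g + 2 + p) * (2 ^ (v * g) * \<Omega>) - of_int z * 2 ^ (g + 2 + p)\<bar> \<le> 3 / 4 * 2 ^ p"
    using close[of u] u(3,4) unfolding circ_close_def t lu by auto
  define S where "S = int (x u) - z * 2 ^ (g + 2) * 2 ^ p"
  have "real_of_int S - 2 ^ p * y = real (x u) - 2 ^ (g + 2 + p) * (2 ^ (v * g) * \<Omega>) - of_int z * 2 ^ (g + 2 + p)"
    by (simp add: S_def y_def u_def power_add algebra_simps)
  with z have "\<bar>real_of_int S - 2 ^ p * y\<bar> \<le> 3 / 4 * 2 ^ p" by simp
  then have S: "\<bar>real_of_int S / 2 ^ p - y\<bar> \<le> 3 / 4"
    by (simp add: abs_le_iff field_simps)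
  \<comment> \<open>The tail has at least two more bits than p below its top two, which shrinks an
    error of (3/4) 2^p to less than 1/4 after division by 2^w.\<close>
  have "(2::real) ^ (p + 2) \<le> 2 ^ w" using pw by (intro power_increasing) auto
  then have "4 * (2::real) ^ p \<le> 2 ^ w" by (simp add: power_add)
  moreover have "\<bar>of_int R - 2 ^ w * y\<bar> \<le> 3 / 4 * 2 ^ p"
    using R unfolding K by (simp add: y_def power_add mult_ac)
  moreover have "(0::real) \<le> 2 ^ p" by simp
  ultimately have "\<bar>of_int R - 2 ^ w * y\<bar> \<le> 1 / 4 * 2 ^ w" by linarith
  then have R': "\<bar>real_of_int R / 2 ^ w - y\<bar> \<le> 1 / 4"
    by (simp add: abs_le_iff field_simps)
  define c where "c = R div 2 ^ w - S div 2 ^ p"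
  \<comment> \<open>The two scaled readings differ by at most 3/4 + 1/4 = 1, so their floors differ
    by at most 1.\<close>
  have "\<bar>c\<bar> \<le> 1" unfolding c_def div_eq_floor using S R' by linarith
  then have c: "c \<in> {-1, 0, 1}" by auto
  have "int (x u) = S + z * 2 ^ (g + 2) * 2 ^ p" by (simp add: S_def)
  \<comment> \<open>The wrap-around is a multiple of 2^p, so it passes through the truncation and
    leaves a multiple of 2^(g + 2), which vanishes modulo 2^n.\<close>
  then have "int (mv u) = S div 2 ^ p + z * 2 ^ (g + 2)"
    using mv[of u] u by (simp add: meas_def t_par_def zdiv_int)
  then have "int (mv u) mod 2 ^ n_par L k u = (R div 2 ^ w - c) mod 2 ^ n_par L k u"
    by (simp add: n c_def)
  then have "comb_step L k p mv u (R mod 2 ^ (w + 2)) = Some (R mod 2 ^ (n_par L k u + w))"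
    using comb_step_eq[OF len1 _ c] n by simp
  then have "comb_iter L k p mv (Suc d) = Some (R mod 2 ^ len_par L k p (k - Suc d))"
    using IH by (simp add: u(1)[symmetric] u(2) len1[simplified] len)
  with R show ?case by blast
qed

lemma good_outcomeI:
  assumes k: "k dvd L" "1 \<le> k" "2 \<le> L"
    and x: "\<And>j. j \<in> {1..k} \<Longrightarrow> x j < 2 ^ t_par L k p j"
    and mv: "\<And>j. j \<in> {1..k} \<Longrightarrow> mv j = meas L k p x j"
    and close: "\<And>j. j \<in> {1..k} \<Longrightarrow>
      circ_close (t_par L k p j) (2 ^ (l_par L k j - 1) * real s / real r) (3 / 4 * 2 ^ p) (x j)"
    and s: "s < r" "r < 2 ^ L"
  shows "good_outcome L k p r mv"
proof -
  define K where "K = 2 * L + 1 + p"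
  define D :: real where "D = 1 / 2 ^ (2 * L + 1)"
  have len: "len_par L k p 1 = K" using k by (simp add: len_par_def l_par_eq K_def)
  obtain R :: int where comb: "combine_results L k p mv = Some (R mod 2 ^ K)"
    and R: "\<bar>of_int R - 2 ^ K * (real s / real r)\<bar> \<le> 3 / 4 * 2 ^ p"
    using comb_iter_approx[OF k x mv, where \<Omega> = "real s / real r" and d = "k - 1"] close k
    by (auto simp: combine_results_def len[simplified] K_def add_ac)
  define q where "q = R div 2 ^ K"
  define m where "m = R mod 2 ^ K"
  have "R = q * 2 ^ K + m" by (simp add: q_def m_def div_mult_mod_eq)
  then have Rm: "real_of_int R = of_int q * 2 ^ K + of_int m" by simp
  have "\<bar>of_int R - 2 ^ K * (real s / real r)\<bar> \<le> 2 ^ p" using R by (rule order_trans) simp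
  also have "(2::real) ^ p = D * 2 ^ K" by (simp add: D_def K_def power_add)
  finally have "\<bar>of_int R / 2 ^ K - real s / real r\<bar> \<le> D"
    using s by (simp add: abs_le_iff field_simps)
  then have close': "\<bar>of_int m / 2 ^ K + of_int q - real s / real r\<bar> \<le> D"
    by (simp add: Rm add_divide_distrib add.commute)
  have "0 \<le> m" "m < 2 ^ K" by (simp_all add: m_def)
  then have m: "0 \<le> real_of_int m / 2 ^ K" "real_of_int m / 2 ^ K < 1"
    by (simp_all add: divide_less_eq)
  have "real r < 2 ^ L" using s(2) by (metis of_nat_less_iff of_nat_numeral of_nat_power)
  also have "\<dots> \<le> 2 ^ (2 * L + 1)" by (intro power_increasing) auto
  finally have D: "D < 1 / real r" using s by (simp add: D_def divide_strict_left_mono)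
  have r1: "1 / real r \<le> 1" "real s / real r + 1 / real r \<le> 1" "0 \<le> real s / real r"
    using s by (auto simp: divide_simps)
  have "real_of_int q < 1" using close' m D r1 by linarith
  moreover have "- 2 < real_of_int q" using close' m D r1 by linarith
  ultimately consider "q = 0" | "q = - 1" by linarith
  then have "\<exists>s0\<in>{0..r}. \<bar>real_of_int m / 2 ^ K - real s0 / real r\<bar> \<le> D"
  proof cases
    case 1
    then show ?thesis using close' s by (intro bexI[of _ s]) auto
  next
    case 2
    then have "real_of_int q = - 1" by simp
    then have "real s / real r < 1 / real r" using close' m D by linarith
    then have "s = 0" using s by (simp add: divide_less_cancel)
    then show ?thesis using close' s 2 by (intro bexI[of _ r]) auto
  qed
  then show ?thesis using comb by (auto simp: good_outcome_def m_def K_def D_def)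
qed

section \<open>Outcome distribution and success probability\<close>

lemma inj_on_power_mod:
  fixes a N :: nat
  assumes "coprime a N"
  shows "inj_on (\<lambda>q. a ^ q mod N) {..<ord N a}"
proof (rule inj_onI)
  fix i j assume ij: "i \<in> {..<ord N a}" "j \<in> {..<ord N a}" "a ^ i mod N = a ^ j mod N"
  then have "[i = j] (mod ord N a)"
    using order_divides_expdiff[of N a i j] assms by (simp add: cong_def coprime_commute)
  then show "i = j" using ij by (simp add: cong_def)
qed

text \<open>The residues a^q mod N are distinct basis states of C. The amplitude at such a state is
  \<open>V q / r\<close>, the Fourier transform in s of the register amplitudes \<open>A s\<close>,
  and it is 0 at every other state; Parseval then leaves a sum over s of squares.\<close>

lemma sum_cmod_phi_final:
  assumes "coprime a N" "0 < N" "N < 2 ^ L" and r: "r = ord N a"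
  shows "(\<Sum>c<2 ^ L. (cmod (phi_final L k p N a r x c))\<^sup>2)
       = (\<Sum>s<r. \<Prod>j\<in>{1..k}.
            (cmod (psi (t_par L k p j) (2 ^ (l_par L k j - 1) * real s / real r) (x j)))\<^sup>2) / real r"
proof -
  define A where "A s = (\<Prod>j\<in>{1..k}.
     psi (t_par L k p j) (2 ^ (l_par L k j - 1) * real s / real r) (x j))" for s
  define V where "V q = (\<Sum>s<r. A s * cis (- (2 * pi * real s * real q / real r)))" for q
  define f where "f q = a ^ q mod N" for q
  have r0: "0 < r" using assms by (simp add: coprime_commute)
  have sr: "complex_of_real (sqrt (real r)) * complex_of_real (sqrt (real r)) = of_nat r"
    unfolding of_real_mult[symmetric] by simp
  have inj: "inj_on f {..<r}" using inj_on_power_mod[OF assms(1)] by (simp add: f_def[abs_def] r)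
  have sub: "f ` {..<r} \<subseteq> {..<2 ^ L}"
    using assms by (auto simp: f_def intro: less_trans[OF mod_less_divisor])
  have phi: "phi_final L k p N a r x c = (\<Sum>q<r. if f q = c then V q else 0) / of_nat r" for c
  proof -
    have "phi_final L k p N a r x c
        = (\<Sum>s<r. \<Sum>q<r. if f q = c then A s * cis (- (2 * pi * real s * real q / real r)) else 0) / of_nat r"
      unfolding phi_final_def u_state_def A_def[symmetric] f_def[symmetric]
      by (simp add: sum_distrib_left sum_divide_distrib[symmetric] sr if_distrib cong: if_cong)
    also have "(\<Sum>s<r. \<Sum>q<r. if f q = c then A s * cis (- (2 * pi * real s * real q / real r)) else 0)
        = (\<Sum>q<r. if f q = c then V q else 0)"
      by (subst sum.swap) (auto simp: V_def intro!: sum.cong)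
    finally show ?thesis .
  qed
  have phi_f: "phi_final L k p N a r x (f q) = V q / of_nat r" if "q < r" for q
  proof -
    have "(\<Sum>i<r. if f i = f q then V i else 0) = (\<Sum>i<r. if i = q then V i else 0)"
      using inj that by (intro sum.cong) (auto simp: inj_on_def)
    then show ?thesis using that by (simp add: phi)
  qed
  have "(\<Sum>c<2 ^ L. (cmod (phi_final L k p N a r x c))\<^sup>2)
      = (\<Sum>c\<in>f ` {..<r}. (cmod (phi_final L k p N a r x c))\<^sup>2)"
    using sub by (intro sum.mono_neutral_right) (auto simp: phi intro!: sum.neutral)
  also have "\<dots> = (\<Sum>q<r. (cmod (V q))\<^sup>2) / (real r)\<^sup>2"
    using inj by (simp add: sum.reindex phi_f norm_divide power_divide sum_divide_distrib)
  also have "(\<Sum>q<r. (cmod (V q))\<^sup>2) = real r * (\<Sum>s<r. (cmod (A s))\<^sup>2)"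
    unfolding V_def by (rule parseval_dft)
  finally show ?thesis
    using r0 by (simp add: A_def prod_norm[symmetric] prod_power_distrib power2_eq_square prod.distrib)
qed

text \<open>Measuring only leading qubits amounts to grouping full basis outcomes by their reading,
  and being good depends on the reading alone. The tail bounds can therefore be applied to fully
  measured registers.\<close>

lemma success_prob_eq_sum:
  "success_prob L k p N a r
   = (\<Sum>x | x \<in> A_basis L k p \<and> good_outcome L k p r (restrict (meas L k p x) {1..k}).
        \<Sum>c<2 ^ L. (cmod (phi_final L k p N a r x c))\<^sup>2)"
proof -
  define g where "g x = restrict (meas L k p x) {1..k}" for x
  define S where "S = {x \<in> A_basis L k p. good_outcome L k p r (g x)}"
  define T where "T = {mv \<in> outcomes L k p. good_outcome L k p r mv}"
  have fin: "finite (A_basis L k p)" by (auto simp: A_basis_def intro!: finite_PiE)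
  have T: "T = g ` S" by (auto simp: T_def S_def g_def outcomes_def)
  have "{x \<in> A_basis L k p. \<forall>j\<in>{1..k}. meas L k p x j = mv j} = {x. x \<in> S \<and> g x = mv}"
    if mv: "mv \<in> T" for mv
  proof -
    \<comment> \<open>Elements of \<open>T\<close> are restricted to {1..k}, so agreement on that
      set is equality of functions.\<close>
    have "(\<forall>j\<in>{1..k}. meas L k p x j = mv j) \<longleftrightarrow> g x = mv" for x
      using mv unfolding T by (auto simp: g_def fun_eq_iff restrict_def)
    then show ?thesis using mv unfolding S_def T_def by auto
  qed
  then have "success_prob L k p N a r
      = (\<Sum>mv\<in>T. \<Sum>x | x \<in> S \<and> g x = mv. \<Sum>c<2 ^ L. (cmod (phi_final L k p N a r x c))\<^sup>2)"
    by (simp add: success_prob_def outcome_prob_def T_def[symmetric] cong: sum.cong)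
  also have "\<dots> = (\<Sum>x\<in>S. \<Sum>c<2 ^ L. (cmod (phi_final L k p N a r x c))\<^sup>2)"
    using fin by (intro sum.group) (auto simp: S_def T)
  finally show ?thesis by (simp add: S_def g_def)
qed

text \<open>For fixed s the registers are independent. The box of jointly close estimates consists
  of good outcomes and has probability at least (1 - \<delta>)^k >= 1 - k \<delta>; averaging over s
  preserves this bound.\<close>

lemma success_prob_ge:
  assumes k: "k dvd L" "1 \<le> k" "2 \<le> L"
    and N: "coprime a N" "2 \<le> N" "N < 2 ^ L" and r: "r = ord N a"
    and p: "1 \<le> p"
  shows "1 - real k / (3 * (3 / 4 * 2 ^ p - 1 / 2)) \<le> success_prob L k p N a r"
proof -
  define T :: real where "T = 3 / 4 * 2 ^ p"
  define \<delta> where "\<delta> = 1 / (3 * (T - 1 / 2))"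
  define t where "t = t_par L k p"
  define \<omega> where "\<omega> s j = 2 ^ (l_par L k j - 1) * real s / real r" for s j
  define P where "P s j y = (cmod (psi (t j) (\<omega> s j) y))\<^sup>2" for s j y
  define G where "G s j = {y. y < 2 ^ t j \<and> circ_close (t j) (\<omega> s j) T y}" for s j
  define S where "S = {x \<in> A_basis L k p. good_outcome L k p r (restrict (meas L k p x) {1..k})}"
  have r0: "0 < r" using N r by (simp add: coprime_commute)
  have "r \<le> totient N" unfolding r using N
    by (intro dvd_imp_le order_divides_totient) (auto simp: coprime_commute)
  also have "\<dots> < 2 ^ L" using totient_le[of N] N by linarith
  finally have rL: "r < 2 ^ L" .
  have "(2::real) ^ 1 \<le> 2 ^ p" using p by (intro power_increasing) auto
  then have T: "1 \<le> T" by (simp add: T_def)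
  then have \<delta>: "0 \<le> \<delta>" "\<delta> \<le> 1" by (auto simp: \<delta>_def divide_simps)
  \<comment> \<open>Natural subtraction in \<open>n_par\<close> could truncate, so l_j <= l_(j+1) is
    checked; j = k is separate because l_(k+1) = 2L breaks the arithmetic progression.\<close>
  have t2: "2 \<le> t j" if "j \<in> {1..k}" for j
  proof -
    have "l_par L k j \<le> l_par L k (j + 1)"
    proof (cases "j = k")
      case True
      have "(k - 1) * (L div k) \<le> L - 1"
      proof -
        obtain g where g: "L = k * g" using k by blast
        then have "1 \<le> g" using k by (cases g) auto
        moreover have "L div k = g" using g k by simp
        ultimately show ?thesis using g k by (cases k) auto
      qed
      then show ?thesis using k True by (simp add: l_par_def)
    qed (use that in \<open>auto simp: l_par_def\<close>)
    then show ?thesis by (simp add: t_def t_par_def n_par_def)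
  qed
  have Gsum: "1 - \<delta> \<le> (\<Sum>y\<in>G s j. P s j y)" if "j \<in> {1..k}" for s j
  proof -
    let ?B = "{y. y < 2 ^ t j \<and> \<not> circ_close (t j) (\<omega> s j) T y}"
    have "{..<2 ^ t j} = G s j \<union> ?B" by (auto simp: G_def)
    then have "(\<Sum>y<2 ^ t j. P s j y) = (\<Sum>y\<in>G s j. P s j y) + (\<Sum>y\<in>?B. P s j y)"
      by (simp add: G_def) (subst sum.union_disjoint[symmetric], auto)
    moreover have "(\<Sum>y\<in>?B. P s j y) \<le> \<delta>"
      unfolding P_def \<delta>_def by (rule psi_tail[OF t2[OF that] T])
    ultimately show ?thesis using psi_norm[of "t j" "\<omega> s j"] by (simp add: P_def)
  qed
  have sub: "PiE {1..k} (G s) \<subseteq> S" if "s < r" for s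
  proof
    fix x assume x: "x \<in> PiE {1..k} (G s)"
    then have xG: "x j \<in> G s j" if "j \<in> {1..k}" for j using that by (rule PiE_mem)
    have "x \<in> A_basis L k p"
      using x by (auto simp: A_basis_def G_def t_def PiE_iff)
    moreover have "good_outcome L k p r (restrict (meas L k p x) {1..k})"
    proof (rule good_outcomeI[OF k, where s = s and x = x])
      show "x j < 2 ^ t_par L k p j"
        "circ_close (t_par L k p j) (2 ^ (l_par L k j - 1) * real s / real r) (3 / 4 * 2 ^ p) (x j)"
        if "j \<in> {1..k}" for j
        using xG[OF that] by (auto simp: G_def t_def \<omega>_def T_def)
    qed (use that rL in auto)
    ultimately show "x \<in> S" by (simp add: S_def)
  qed
  have finS: "finite S" by (auto simp: S_def A_basis_def intro!: finite_PiE)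
  have prod: "1 - real k * \<delta> \<le> (\<Sum>x\<in>S. \<Prod>j\<in>{1..k}. P s j (x j))" if "s < r" for s
  proof -
    have "1 - real k * \<delta> \<le> (\<Prod>j\<in>{1..k}. 1 - \<delta>)"
      using Weierstrass_prod_ineq[of "{1..k}" "\<lambda>_. \<delta>"] \<delta> by simp
    also have "\<dots> \<le> (\<Prod>j\<in>{1..k}. \<Sum>y\<in>G s j. P s j y)"
      using Gsum \<delta> by (intro prod_mono) auto
    also have "\<dots> = (\<Sum>x\<in>PiE {1..k} (G s). \<Prod>j\<in>{1..k}. P s j (x j))"
      by (intro prod_sum_PiE) (auto simp: G_def)
    also have "\<dots> \<le> (\<Sum>x\<in>S. \<Prod>j\<in>{1..k}. P s j (x j))"
      using sub[OF that] finS by (intro sum_mono2) (auto simp: P_def intro!: prod_nonneg)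
    finally show ?thesis .
  qed
  have "(\<Sum>s<r. 1 - real k * \<delta>) \<le> (\<Sum>s<r. \<Sum>x\<in>S. \<Prod>j\<in>{1..k}. P s j (x j))"
    using prod by (intro sum_mono) simp
  then have "real r * (1 - real k * \<delta>) \<le> (\<Sum>x\<in>S. \<Sum>s<r. \<Prod>j\<in>{1..k}. P s j (x j))"
    by (subst sum.swap) simp
  then have "1 - real k * \<delta> \<le> (\<Sum>x\<in>S. \<Sum>s<r. \<Prod>j\<in>{1..k}. P s j (x j)) / real r"
    using r0 by (simp add: pos_le_divide_eq mult.commute)
  also have "\<dots> = success_prob L k p N a r"
    using N by (simp add: success_prob_eq_sum S_def sum_cmod_phi_final[OF N(1) _ N(3) r]
      sum_divide_distrib P_def t_def \<omega>_def)
  finally show ?thesis by (simp add: \<delta>_def T_def)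
qed

text \<open>With b = k / (2 \<epsilon>), the choice of p gives P = 2^p >= 2 + b. The denominator
  (9/4) P - 3/2 is then at least 3 + (9/4) b, which exceeds 2 b = k / \<epsilon>: the factor 3 of
  the tail bound pays for the reduced tolerance 3/4.\<close>

lemma p_par_bound:
  assumes "0 < \<epsilon>" "1 \<le> k"
  shows "1 \<le> p_par \<epsilon> k" "real k / (3 * (3 / 4 * 2 ^ p_par \<epsilon> k - 1 / 2)) \<le> \<epsilon>"
proof -
  define b where "b = 1 / (2 * (\<epsilon> / real k))"
  define P :: real where "P = 2 ^ p_par \<epsilon> k"
  have b: "0 < b" "real k = 2 * \<epsilon> * b" using assms by (auto simp: b_def)
  have "2 + b = 2 powr log 2 (2 + b)" using b by simp
  also have "\<dots> \<le> 2 powr real (p_par \<epsilon> k)"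
    unfolding p_par_def b_def by (intro powr_mono real_nat_ceiling_ge) auto
  also have "\<dots> = P" by (simp add: powr_realpow P_def)
  finally have P: "2 + b \<le> P" .
  have "p_par \<epsilon> k \<noteq> 0" using P b by (intro notI) (simp add: P_def)
  then show "1 \<le> p_par \<epsilon> k" by simp
  have "\<epsilon> * (2 * b) \<le> \<epsilon> * (3 * (3 / 4 * P - 1 / 2))"
    using P b assms by (intro mult_left_mono) auto
  then have "real k \<le> \<epsilon> * (3 * (3 / 4 * P - 1 / 2))" using b by simp
  then show "real k / (3 * (3 / 4 * 2 ^ p_par \<epsilon> k - 1 / 2)) \<le> \<epsilon>"
    using P b unfolding P_def[symmetric] by (subst pos_divide_le_eq) auto
qed

theorem theorem1:
  fixes L k N a r :: nat and \<epsilon> :: real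
  assumes "L \<ge> 1" and "k \<ge> 1" and "k dvd L"
    and "2 ^ (L - 1) \<le> N" and "N < 2 ^ L"
    and "0 < a" and "a < N" and "coprime a N"
    and "r = ord N a"
    and "\<epsilon> > 0"
  shows "success_prob L k (p_par \<epsilon> k) N a r \<ge> 1 - \<epsilon>"
proof -
  have N: "2 \<le> N" using assms by linarith
  have "L \<noteq> 1"
    using N assms(5) by auto
  then have "2 \<le> L" using assms(1) by linarith
  with success_prob_ge[of k L a N r "p_par \<epsilon> k"] p_par_bound[of \<epsilon> k] N assms
  show ?thesis by simp
qed

end
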